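(* Let $K$ be an integer and let $m>1$ be odd. Then: (1) if $m>3$, then $\omega_K(m)=4$ if and only if $\alpha_K(m)\equiv\pm1\pmod 4$; (2) $\omega_K(m)=2$ if and only if $4\mid\pi_K(m)$ and $2\mid\alpha_K(m)$; (3) $\omega_K(m)=1$ if and only if $4\nmid\pi_K(m)$.
   Context: For an integer $K$, the $K$-Fibonacci sequence is $F_{K,0}=0$, $F_{K,1}=1$, $F_{K,n}=KF_{K,n-1}+F_{K,n-2}$ for $n\ge2$. For an integer $m\ge 2$, $\pi_K(m)$ is the least positive period of $(F_{K,n}\bmod m)$, $\alpha_K(m)$ is the least positive index $n$ with $m\mid F_{K,n}$, and $\omega_K(m)$ is the number of indices $0\le n<\pi_K(m)$ with $m\mid F_{K,n}$. *)

theory Defs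
  imports "HOL-Number_Theory.Cong"
begin

fun fib_K :: "int \<Rightarrow> nat \<Rightarrow> int" where
  "fib_K K 0 = 0"
| "fib_K K (Suc 0) = 1"
| "fib_K K (Suc (Suc n)) = K * fib_K K (Suc n) + fib_K K n"

(* Periods are pure, i.e. the congruence holds from index 0 on.  A positive period and a
   positive index of a zero exist for every K and m > 1, because the recurrence is
   invertible modulo m; so both LEAST operators below are meaningful. *)

definition pi_K :: "int \<Rightarrow> int \<Rightarrow> nat" where
  "pi_K K m = (LEAST p. p > 0 \<and> (\<forall>n. [fib_K K (n + p) = fib_K K n] (mod m)))"

definition alpha_K :: "int \<Rightarrow> int \<Rightarrow> nat" where
  "alpha_K K m = (LEAST n. n > 0 \<and> m dvd fib_K K n)"

definition omega_K :: "int \<Rightarrow> int \<Rightarrow> nat" where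
  "omega_K K m = card {n. n < pi_K K m \<and> m dvd fib_K K n}"

end

theory Submission
  imports Defs
begin

text \<open>
  Put \<open>a = \<alpha>\<^sub>K(m)\<close> and \<open>s = F(a + 1)\<close>. Modulo \<open>m\<close> the sequence satisfies
  \<open>F(n + a) = s F(n)\<close>, so the zeros are the multiples of \<open>a\<close>, and the periods are the
  multiples \<open>a q\<close> with \<open>s ^ q = 1\<close>. Cassini's identity gives \<open>s\<^sup>2 = (-1) ^ a\<close>, so the order
  of \<open>s\<close> is 4 if \<open>a\<close> is odd and 1 or 2 if \<open>a\<close> is even. In the case \<open>s = 1\<close> the
  multiple of four \<open>a = 2 k\<close> with \<open>k\<close> even is impossible: \<open>F(k) = F(- k) = - F(k)\<close> would yield
  the smaller zero \<open>k\<close>.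
\<close>

section \<open>Addition formula and Cassini identity\<close>

text \<open>Both sides obey the recurrence in \<open>n\<close>, so agreement at 0 and 1
  suffices.\<close>

lemma fib_K_add: "fib_K K (Suc (n + k)) = fib_K K (Suc n) * fib_K K (Suc k) + fib_K K n * fib_K K k"
proof (induction K n rule: fib_K.induct)
  case (3 K n)
  have "fib_K K (Suc (Suc (Suc n) + k)) = K * fib_K K (Suc (Suc n + k)) + fib_K K (Suc (n + k))"
    by simp
  also have "\<dots> = fib_K K (Suc (Suc (Suc n))) * fib_K K (Suc k) + fib_K K (Suc (Suc n)) * fib_K K k"
    unfolding 3 by (simp add: algebra_simps)
  finally show ?case .
qed simp_all

text \<open>The form y^2 - K y x - x^2 changes sign under the step (x, y) -> (y, K y + x).\<close>

lemma fib_K_cassini: "(fib_K K (Suc n))\<^sup>2 - K * fib_K K (Suc n) * fib_K K n - (fib_K K n)\<^sup>2 = (-1) ^ n"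
proof (induction n)
  case (Suc n)
  have "(fib_K K (Suc (Suc n)))\<^sup>2 - K * fib_K K (Suc (Suc n)) * fib_K K (Suc n) - (fib_K K (Suc n))\<^sup>2
      = - ((fib_K K (Suc n))\<^sup>2 - K * fib_K K (Suc n) * fib_K K n - (fib_K K n)\<^sup>2)"
    by (simp add: power2_eq_square algebra_simps)
  then show ?case
    using Suc by simp
qed simp

section \<open>Zeros modulo \<open>m\<close>\<close>

text \<open>By pigeonhole two pairs of consecutive residues agree. The recurrence also runs
  backwards, so the agreement at \<open>i\<close> and \<open>i + d\<close> descends to 0 and
  \<open>d\<close>.\<close>

lemma fib_K_zero_exists:
  assumes "m > 0"
  shows "\<exists>n>0. m dvd fib_K K n"
proof -
  let ?f = "\<lambda>n. (fib_K K n mod m, fib_K K (Suc n) mod m)"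
  have "range ?f \<subseteq> {0..<m} \<times> {0..<m}"
    using assms by auto
  then have "finite (range ?f)"
    using finite_subset by blast
  then have "\<not> inj ?f"
    using finite_imageD infinite_UNIV_nat by blast
  then obtain i j where "i < j" "?f i = ?f j"
    unfolding inj_def by (metis linorder_neqE_nat)
  then obtain d where d: "d > 0" "?f i = ?f (i + d)"
    using less_imp_add_positive by blast
  have "?f i = ?f (i + d) \<Longrightarrow> m dvd fib_K K d"
  proof (induction i)
    case 0
    then show ?case
      by (simp add: mod_0_imp_dvd)
  next
    case (Suc i)
    then have 1: "[fib_K K (Suc i) = fib_K K (Suc i + d)] (mod m)"
      and "[fib_K K (Suc (Suc i)) = fib_K K (Suc (Suc i + d))] (mod m)"
      unfolding cong_def by simp_all
    then have "[fib_K K (Suc (Suc i)) - K * fib_K K (Suc i)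
        = fib_K K (Suc (Suc i + d)) - K * fib_K K (Suc i + d)] (mod m)"
      by (intro cong_diff cong_mult cong_refl)
    then have "[fib_K K i = fib_K K (i + d)] (mod m)"
      by simp
    with 1 show ?case
      by (intro Suc.IH) (simp add: cong_def)
  qed
  with d show ?thesis
    by blast
qed

lemma alpha_K_props:
  assumes "m > 0"
  shows alpha_K_pos: "alpha_K K m > 0"
    and alpha_K_dvd_fib: "m dvd fib_K K (alpha_K K m)"
    and alpha_K_le: "\<And>n. n > 0 \<Longrightarrow> m dvd fib_K K n \<Longrightarrow> alpha_K K m \<le> n"
proof -
  have "alpha_K K m > 0 \<and> m dvd fib_K K (alpha_K K m)"
    unfolding alpha_K_def by (rule LeastI_ex) (use fib_K_zero_exists[OF assms] in blast)
  then show "alpha_K K m > 0" "m dvd fib_K K (alpha_K K m)"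
    by auto
  show "\<And>n. n > 0 \<Longrightarrow> m dvd fib_K K n \<Longrightarrow> alpha_K K m \<le> n"
    unfolding alpha_K_def by (rule Least_le) simp
qed

text \<open>In the addition formula, the term containing F(a) vanishes modulo
  \<open>m\<close>.\<close>

lemma fib_K_shift_zero:
  assumes "m dvd fib_K K a"
  shows "[fib_K K (n + a) = fib_K K n * fib_K K (Suc a)] (mod m)"
proof (cases n)
  case 0
  then show ?thesis
    using assms by (simp add: cong_0_iff)
next
  case (Suc k)
  then show ?thesis
    using assms by (simp add: fib_K_add cong_iff_dvd_diff)
qed

lemma fib_K_zero_cassini:
  assumes "m dvd fib_K K a"
  shows "[(fib_K K (Suc a))\<^sup>2 = (-1) ^ a] (mod m)"
proof -
  have "(fib_K K (Suc a))\<^sup>2 - (-1) ^ a = fib_K K a * (K * fib_K K (Suc a) + fib_K K a)"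
    using fib_K_cassini[of K a] by (simp add: power2_eq_square algebra_simps)
  then show ?thesis
    using assms by (simp add: cong_iff_dvd_diff)
qed

text \<open>The square of F(a + 1) is 1 or -1 modulo \<open>m\<close>, so F(a + 1) is a
  unit.\<close>

lemma coprime_fib_K_Suc_zero:
  assumes "m dvd fib_K K a"
  shows "coprime m (fib_K K (Suc a))"
proof -
  have "coprime m ((fib_K K (Suc a))\<^sup>2)"
    using fib_K_zero_cassini[OF assms] cong_imp_coprime[of "(-1) ^ a" "(fib_K K (Suc a))\<^sup>2" m]
    by (simp add: cong_sym coprime_commute)
  then show ?thesis
    by simp
qed

lemma fib_K_shift_mult:
  assumes "m dvd fib_K K a"
  shows "[fib_K K (n + a * q) = fib_K K n * fib_K K (Suc a) ^ q] (mod m)"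
proof (induction q)
  case (Suc q)
  have "[fib_K K (n + a * q + a) = fib_K K (n + a * q) * fib_K K (Suc a)] (mod m)"
    by (rule fib_K_shift_zero[OF assms])
  also have "[fib_K K (n + a * q) * fib_K K (Suc a)
      = fib_K K n * fib_K K (Suc a) ^ q * fib_K K (Suc a)] (mod m)"
    by (rule cong_scalar_right[OF Suc])
  finally show ?case
    by (simp add: algebra_simps)
qed simp

text \<open>Shifting by multiples of \<alpha> only multiplies by a unit, so \<open>n\<close> may be
  reduced modulo \<alpha>; minimality of \<alpha> then leaves only remainder 0.\<close>

lemma dvd_fib_K_iff:
  assumes "m > 0"
  shows "m dvd fib_K K n \<longleftrightarrow> alpha_K K m dvd n"
proof -
  let ?a = "alpha_K K m"
  have a: "m dvd fib_K K ?a"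
    by (rule alpha_K_dvd_fib[OF assms])
  have "[fib_K K n = fib_K K (n mod ?a) * fib_K K (Suc ?a) ^ (n div ?a)] (mod m)"
    using fib_K_shift_mult[OF a, of "n mod ?a" "n div ?a"] by simp
  then have "m dvd fib_K K n \<longleftrightarrow> m dvd fib_K K (n mod ?a) * fib_K K (Suc ?a) ^ (n div ?a)"
    by (rule cong_dvd_iff)
  also have "\<dots> \<longleftrightarrow> m dvd fib_K K (n mod ?a)"
    using coprime_fib_K_Suc_zero[OF a] by (simp add: coprime_dvd_mult_left_iff)
  also have "\<dots> \<longleftrightarrow> n mod ?a = 0"
  proof
    assume "m dvd fib_K K (n mod ?a)"
    then show "n mod ?a = 0"
      using alpha_K_le[OF assms, of "n mod ?a" K] mod_less_divisor[OF alpha_K_pos[OF assms], of n K]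
      by (meson gr0I not_less)
  qed simp
  finally show ?thesis
    by (simp add: dvd_eq_mod_eq_0)
qed

section \<open>Periods and the number of zeros in a period\<close>

text \<open>A period is itself the index of a zero, since F(0) = 0, hence a multiple of \<alpha>.
  Comparing the values at index 1 gives the condition on the power.\<close>

lemma fib_K_period_iff:
  assumes "m > 0"
  shows "(\<forall>n. [fib_K K (n + p) = fib_K K n] (mod m)) \<longleftrightarrow>
    (\<exists>q. p = alpha_K K m * q \<and> [fib_K K (Suc (alpha_K K m)) ^ q = 1] (mod m))"
    (is "?L \<longleftrightarrow> ?R")
proof
  let ?a = "alpha_K K m"
  have a: "m dvd fib_K K ?a"
    by (rule alpha_K_dvd_fib[OF assms])
  {
    assume L: ?L
    from L[rule_format, of 0] have "m dvd fib_K K p"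
      by (simp add: cong_0_iff)
    then obtain q where q: "p = ?a * q"
      using dvd_fib_K_iff[OF assms] by blast
    have "[fib_K K (Suc ?a) ^ q = 1] (mod m)"
      using fib_K_shift_mult[OF a, of "Suc 0" q] L[rule_format, of "Suc 0"] q
      by (simp add: cong_def)
    with q show ?R
      by blast
  next
    assume ?R
    then obtain q where q: "p = ?a * q" "[fib_K K (Suc ?a) ^ q = 1] (mod m)"
      by blast
    show ?L
    proof
      fix n
      have "[fib_K K (n + p) = fib_K K n * fib_K K (Suc ?a) ^ q] (mod m)"
        using fib_K_shift_mult[OF a] q by simp
      also have "[fib_K K n * fib_K K (Suc ?a) ^ q = fib_K K n * 1] (mod m)"
        by (rule cong_scalar_left[OF q(2)])
      finally show "[fib_K K (n + p) = fib_K K n] (mod m)"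
        by simp
    qed
  }
qed

text \<open>The hypotheses say that \<open>w\<close> is the multiplicative order of F(\<alpha> + 1)
  modulo \<open>m\<close>.\<close>

lemma pi_K_eq:
  assumes "m > 0" "w > 0"
    and "[fib_K K (Suc (alpha_K K m)) ^ w = 1] (mod m)"
    and "\<And>q. q > 0 \<Longrightarrow> q < w \<Longrightarrow> \<not> [fib_K K (Suc (alpha_K K m)) ^ q = 1] (mod m)"
  shows "pi_K K m = alpha_K K m * w"
  unfolding pi_K_def fib_K_period_iff[OF assms(1)]
proof (rule Least_equality)
  show "0 < alpha_K K m * w \<and> (\<exists>q. alpha_K K m * w = alpha_K K m * q
      \<and> [fib_K K (Suc (alpha_K K m)) ^ q = 1] (mod m))"
    using assms(2,3) alpha_K_pos[OF assms(1)] by auto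
next
  fix p
  assume "0 < p \<and> (\<exists>q. p = alpha_K K m * q \<and> [fib_K K (Suc (alpha_K K m)) ^ q = 1] (mod m))"
  then obtain q where "p = alpha_K K m * q" "q > 0" "[fib_K K (Suc (alpha_K K m)) ^ q = 1] (mod m)"
    by auto
  then show "alpha_K K m * w \<le> p"
    using assms(4)[of q] by (metis mult_le_mono2 not_less)
qed

lemma omega_K_eq:
  assumes "m > 0" "pi_K K m = alpha_K K m * w"
  shows "omega_K K m = w"
proof -
  let ?a = "alpha_K K m"
  have "?a > 0"
    by (rule alpha_K_pos[OF assms(1)])
  then have "n < ?a * w \<and> ?a dvd n \<longleftrightarrow> (\<exists>q<w. n = ?a * q)" for n
    by (metis dvd_def mult_less_cancel1)
  then have "{n. n < pi_K K m \<and> m dvd fib_K K n} = (*) ?a ` {..<w}"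
    unfolding dvd_fib_K_iff[OF assms(1)] assms(2) by blast
  moreover have "inj_on ((*) ?a) {..<w}"
    using \<open>?a > 0\<close> by (simp add: inj_on_def)
  ultimately show ?thesis
    by (simp add: omega_K_def card_image)
qed

section \<open>The order of the multiplier for odd \<open>m\<close>\<close>

text \<open>This is the reflection F(-k) = -F(k) for even \<open>k\<close>, carried out without
  negative indices: 2 F(k) is a combination of F(2k) and F(2k + 1) - 1.\<close>

lemma dvd_fib_K_half_period:
  assumes "odd m" "even k" "m dvd fib_K K (2 * k)" "[fib_K K (Suc (2 * k)) = 1] (mod m)"
  shows "m dvd fib_K K k"
proof -
  define x y where "x = fib_K K k" and "y = fib_K K (Suc k)"
  have c: "y\<^sup>2 - K * y * x - x\<^sup>2 = 1"
    using fib_K_cassini[of K k] assms(2) by (simp add: x_def y_def)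
  have F1: "fib_K K (Suc (2 * k)) = y\<^sup>2 + x\<^sup>2"
    using fib_K_add[of K k k] by (simp add: x_def y_def mult_2 power2_eq_square)
  \<comment> \<open>F(2k) is found as F(2k + 2) - K F(2k + 1), which avoids the predecessor of
    \<open>k\<close>.\<close>
  have "fib_K K (Suc (Suc (2 * k))) = (K * y + x) * y + y * x"
    using fib_K_add[of K "Suc k" k] by (simp add: x_def y_def mult_2)
  then have F0: "fib_K K (2 * k) = x * (2 * y - K * x)"
    using F1 by (simp add: power2_eq_square algebra_simps)
  have "fib_K K (Suc (2 * k)) - 1 = x * (2 * x + K * y)"
    using F1 c by (simp add: power2_eq_square algebra_simps)
  then have "m dvd x * (2 * x + K * y)"
    using assms(4) by (metis cong_iff_dvd_diff)
  moreover have "m dvd x * (2 * y - K * x)"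
    using assms(3) F0 by simp
  \<comment> \<open>The coefficients \<open>y\<close> and \<open>- x\<close> are chosen so that the
    Cassini form, equal to 1 here, splits off.\<close>
  ultimately have "m dvd y * (x * (2 * y - K * x)) - x * (x * (2 * x + K * y))"
    by (blast intro: dvd_diff dvd_mult)
  also have "y * (x * (2 * y - K * x)) - x * (x * (2 * x + K * y))
      = 2 * x * (y\<^sup>2 - K * y * x - x\<^sup>2)"
    by (simp add: power2_eq_square algebra_simps)
  also have "\<dots> = 2 * x"
    using c by simp
  finally show ?thesis
    using assms(1) by (simp add: x_def coprime_dvd_mult_right_iff)
qed

text \<open>The cases are the possible orders 4, 2 and 1 of the multiplier. The factor 1 is kept so
  that \<open>omega_K_eq\<close> applies uniformly.\<close>

lemma pi_K_alpha_K_cases: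
  assumes "m > 1" "odd m"
  obtains (four) "odd (alpha_K K m)" "pi_K K m = alpha_K K m * 4"
    | (two) "even (alpha_K K m)" "pi_K K m = alpha_K K m * 2"
    | (one) "even (alpha_K K m)" "\<not> 4 dvd alpha_K K m" "pi_K K m = alpha_K K m * 1"
proof -
  define a s where "a = alpha_K K m" and "s = fib_K K (Suc a)"
  have m: "m > 0"
    using assms(1) by simp
  have a: "a > 0" "m dvd fib_K K a"
    using alpha_K_pos[OF m] alpha_K_dvd_fib[OF m] by (simp_all add: a_def)
  have s2: "[s\<^sup>2 = (-1) ^ a] (mod m)"
    using fib_K_zero_cassini[OF a(2)] by (simp add: s_def)
  have pi: "pi_K K m = a * w" if "w > 0" "[s ^ w = 1] (mod m)"
    "\<And>q. q > 0 \<Longrightarrow> q < w \<Longrightarrow> \<not> [s ^ q = 1] (mod m)" for w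
    using pi_K_eq[OF m] that by (simp add: a_def s_def)
  consider "odd a" | "even a" "\<not> [s = 1] (mod m)" | "even a" "[s = 1] (mod m)"
    by blast
  then show ?thesis
  proof cases
    case 1
    then have s2: "[s\<^sup>2 = -1] (mod m)"
      using s2 by simp
    have n2: "\<not> [s\<^sup>2 = 1] (mod m)"
    proof
      assume "[s\<^sup>2 = 1] (mod m)"
      with s2 have "[1 = -1] (mod m)"
        using cong_sym cong_trans by blast
      then have "m dvd 2"
        by (simp add: cong_iff_dvd_diff)
      then have "m \<le> 2"
        by (simp add: zdvd_imp_le)
      with assms show False
        by (cases "m = 2") auto
    qed
    have s4: "[s ^ 4 = 1] (mod m)"
      using cong_pow[OF s2, of 2] by simp
    have "\<not> [s ^ q = 1] (mod m)" if "q > 0" "q < 4" for q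
    proof
      assume q: "[s ^ q = 1] (mod m)"
      from that consider "q = 1" | "q = 2" | "q = 3"
        by linarith
      then show False
      proof cases
        case 1
        then show False
          using q n2 cong_pow[of s 1 m 2] by simp
      next
        case 2
        then show False
          using q n2 by simp
      next
        case 3
        \<comment> \<open>Since also s^4 = 1, a cube equal to 1 would force s = 1.\<close>
        have "[s ^ 3 * s = 1 * s] (mod m)"
          using q 3 cong_scalar_right by blast
        then have "[s = 1] (mod m)"
          using s4 by (simp add: cong_def power_Suc2[symmetric] del: power_Suc)
        then show False
          using n2 cong_pow[of s 1 m 2] by simp
      qed
    qed
    then show ?thesis
      using four 1 pi[of 4] s4 by (simp add: a_def)
  next
    case 2
    have "\<not> [s ^ q = 1] (mod m)" if "q > 0" "q < 2" for q
      using that 2 by (cases "q = 1") auto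
    then show ?thesis
      using two 2 pi[of 2] s2 by (simp add: a_def)
  next
    case 3
    \<comment> \<open>Otherwise half of \<open>a\<close> is even and already the index of a zero,
      against the minimality of \<open>a\<close>.\<close>
    have "\<not> 4 dvd a"
    proof
      assume "4 dvd a"
      then obtain j where "a = 4 * j"
        by blast
      then obtain k where k: "a = 2 * k" "even k"
        using that[of "2 * j"] by simp
      then have "m dvd fib_K K k"
        using dvd_fib_K_half_period[of m k K] a 3 assms(2) by (simp add: s_def)
      then have "a \<le> k"
        using alpha_K_le[OF m, of k K] k a(1) by (simp add: a_def)
      then show False
        using k a(1) by simp
    qed
    then show ?thesis
      using one 3 pi[of 1] by (simp add: a_def)
  qed
qed

theorem theorem4p22:
  fixes K m :: int
  assumes "m > 1" and "odd m"
  shows "(m > 3 \<longrightarrow>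
            (omega_K K m = 4 \<longleftrightarrow>
               [int (alpha_K K m) = 1] (mod 4) \<or> [int (alpha_K K m) = - 1] (mod 4))) \<and>
         (omega_K K m = 2 \<longleftrightarrow> 4 dvd pi_K K m \<and> 2 dvd alpha_K K m) \<and>
         (omega_K K m = 1 \<longleftrightarrow> \<not> 4 dvd pi_K K m)"
proof -
  have m: "m > 0"
    using assms(1) by simp
  have odd_iff: "[int (alpha_K K m) = 1] (mod 4) \<or> [int (alpha_K K m) = - 1] (mod 4)
      \<longleftrightarrow> odd (alpha_K K m)"
  proof -
    have "x mod 4 = 1 \<or> x mod 4 = 3 \<longleftrightarrow> odd x" for x :: int
      by presburger
    from this[of "int (alpha_K K m)"] show ?thesis
      by (simp add: cong_def)
  qed
  \<comment> \<open>The count of zeros is the factor 4, 2 or 1. In the second case \<alpha> is even,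
    so 4 divides 2 \<alpha>; only in the third does 4 fail to divide the period.\<close>
  show ?thesis
  proof (cases rule: pi_K_alpha_K_cases[OF assms, of K, case_names four two one])
    case four
    then show ?thesis
      using omega_K_eq[OF m four(2)] odd_iff by simp
  next
    case two
    then show ?thesis
      using omega_K_eq[OF m two(2)] odd_iff by auto
  next
    case one
    then show ?thesis
      using omega_K_eq[OF m one(3)] odd_iff by simp
  qed
qed

end
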